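(* Let $T$ be a tree on $n \geq 4$ vertices with $T \not\cong S_n$. Then for $0 \leq \alpha < 1$, $\rho_\alpha(T) \leq \rho_\alpha(D_{n,1})$, with equality if and only if $T \cong D_{n,1}$.
   Context: All graphs are finite, simple and undirected. For a graph $G$, $A(G)$ is its adjacency matrix and $D(G)$ the diagonal matrix of vertex degrees. For $\alpha\in[0,1]$, $A_\alpha(G) = \alpha D(G) + (1-\alpha)A(G)$, and $\rho_\alpha(G)$ is the largest eigenvalue of $A_\alpha(G)$. $S_n$ is the star on $n$ vertices. For $n\ge 4$, $D_{n,1}$ is the tree obtained from the vertex-disjoint stars $S_2$ with center $u$ and $S_{n-2}$ with center $v$ by adding the edge $uv$; i.e., $v$ is adjacent to $u$ and to $n-3$ leaves, and $u$ is adjacent to $v$ and one further leaf. *)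

theory Defs
  imports
    "Graph_Theory.Graph_Theory"
    "Jordan_Normal_Form.Char_Poly"
begin

text \<open>
  A finite simple undirected graph is a \<^typ>\<open>'a pair_pre_digraph\<close> satisfying
  \<^const>\<open>pair_graph\<close>: finite, loop-free, and with each edge \<open>{u, v}\<close> given by both arcs
  \<open>(u, v)\<close> and \<open>(v, u)\<close>.
\<close>

definition undirected_graph :: "'a set \<Rightarrow> 'a rel \<Rightarrow> 'a pair_pre_digraph" where
  "undirected_graph V E = \<lparr>pverts = V, parcs = E \<union> E\<inverse>\<rparr>"

text \<open>
  The library constant \<^const>\<open>tree\<close> is not usable here: in a symmetric digraph every edge
  gives a directed cycle \<open>u, v, u\<close> of length 2, which is not a cycle of the undirected graph.
  The directed cycles of length at least 3 are exactly the undirected cycles.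
\<close>

definition undirected_tree :: "'a pair_pre_digraph \<Rightarrow> bool" where
  "undirected_tree G \<longleftrightarrow>
     pair_graph G \<and> Digraph_Component.connected (with_proj G) \<and>
     \<not> (\<exists>p. pre_digraph.cycle (with_proj G) p \<and> 3 \<le> length p)"

text \<open>
  Matrices are indexed by \<open>{0..<n}\<close>, so an ordering of the vertices is fixed.
  The spectrum does not depend on it, see \<open>eigenvalue_A_alpha_iff\<close> below.
\<close>

definition vertex_list :: "'a pair_pre_digraph \<Rightarrow> 'a list" where
  "vertex_list G = (SOME vs. distinct vs \<and> set vs = pverts G)"

definition adjacency_mat :: "'a pair_pre_digraph \<Rightarrow> real mat" where
  "adjacency_mat G =
     mat (card (pverts G)) (card (pverts G))
       (\<lambda>(i, j). if (vertex_list G ! i, vertex_list G ! j) \<in> parcs G then 1 else 0)"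

definition degree_mat :: "'a pair_pre_digraph \<Rightarrow> real mat" where
  "degree_mat G =
     mat_diag (card (pverts G)) (\<lambda>i. real (out_degree (with_proj G) (vertex_list G ! i)))"

definition A_alpha :: "real \<Rightarrow> 'a pair_pre_digraph \<Rightarrow> real mat" where
  "A_alpha \<alpha> G = \<alpha> \<cdot>\<^sub>m degree_mat G + (1 - \<alpha>) \<cdot>\<^sub>m adjacency_mat G"

definition rho_alpha :: "real \<Rightarrow> 'a pair_pre_digraph \<Rightarrow> real" where
  "rho_alpha \<alpha> G = Max {k. eigenvalue (A_alpha \<alpha> G) k}"

definition star :: "nat \<Rightarrow> nat pair_pre_digraph" where
  "star n = undirected_graph {0..<n} ({0} \<times> {1..<n})"

text \<open>
  \<open>D\<^sub>n\<^sub>,\<^sub>1\<close> with \<open>v = 0\<close>, \<open>u = 1\<close>; the leaf at \<open>u\<close> is \<open>2\<close> and the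
  \<open>n - 3\<close> leaves at \<open>v\<close> are \<open>3, \<dots>, n - 1\<close>.
\<close>

definition D_n1 :: "nat \<Rightarrow> nat pair_pre_digraph" where
  "D_n1 n = undirected_graph {0..<n} ({(0, 1), (1, 2)} \<union> {0} \<times> {3..<n})"

lemma pair_graph_undirected_graph:
  assumes "finite V" "E \<subseteq> V \<times> V" "irrefl E"
  shows "pair_graph (undirected_graph V E)"
proof -
  have "finite E" using assms finite_subset by blast
  then show ?thesis
    using assms by unfold_locales (auto simp: undirected_graph_def irrefl_def symmetric_def sym_def)
qed

lemma pair_graph_star: "pair_graph (star n)"
  unfolding star_def by (rule pair_graph_undirected_graph) (auto simp: irrefl_def)

lemma pair_graph_D_n1: "n \<ge> 4 \<Longrightarrow> pair_graph (D_n1 n)"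
  unfolding D_n1_def by (rule pair_graph_undirected_graph) (auto simp: irrefl_def)

lemma vertex_list:
  assumes "finite (pverts G)"
  shows "distinct (vertex_list G)" "set (vertex_list G) = pverts G"
    "length (vertex_list G) = card (pverts G)"
proof -
  have "\<exists>vs. distinct vs \<and> set vs = pverts G"
    using finite_distinct_list[OF assms] by blast
  then have "distinct (vertex_list G) \<and> set (vertex_list G) = pverts G"
    unfolding vertex_list_def by (rule someI_ex)
  then show "distinct (vertex_list G)" "set (vertex_list G) = pverts G"
    "length (vertex_list G) = card (pverts G)"
    by (simp_all add: distinct_card[symmetric])
qed

lemma eigenvalue_A_alpha_iff:
  assumes "finite (pverts G)"
  shows "eigenvalue (A_alpha \<alpha> G) k \<longleftrightarrow>
    (\<exists>x. (\<exists>v\<in>pverts G. x v \<noteq> 0) \<and>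
      (\<forall>v\<in>pverts G. \<alpha> * real (out_degree (with_proj G) v) * x v +
        (1 - \<alpha>) * (\<Sum>w\<in>pverts G. if (v, w) \<in> parcs G then x w else 0) = k * x v))"
    (is "?L \<longleftrightarrow> ?R")
proof -
  let ?n = "card (pverts G)" and ?vs = "vertex_list G"
  have vs: "distinct ?vs" "set ?vs = pverts G" "length ?vs = ?n"
    using vertex_list[OF assms] by auto
  have bij: "bij_betw ((!) ?vs) {0..<?n} (pverts G)"
    by (rule bij_betw_nth[OF vs(1)]) (simp_all only: vs lessThan_atLeast0)
  have dim: "dim_row (A_alpha \<alpha> G) = ?n" "dim_col (A_alpha \<alpha> G) = ?n"
    by (auto simp: A_alpha_def adjacency_mat_def degree_mat_def)
  have row: "(A_alpha \<alpha> G *\<^sub>v vec ?n (\<lambda>i. x (?vs ! i))) $ i =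
      \<alpha> * real (out_degree (with_proj G) (?vs ! i)) * x (?vs ! i) +
      (1 - \<alpha>) * (\<Sum>w\<in>pverts G. if (?vs ! i, w) \<in> parcs G then x w else 0)"
    if i: "i < ?n" for x :: "'a \<Rightarrow> real" and i
  proof -
    let ?d = "real (out_degree (with_proj G) (?vs ! i))"
    have "(A_alpha \<alpha> G *\<^sub>v vec ?n (\<lambda>i. x (?vs ! i))) $ i =
        (\<Sum>j = 0..<?n. (if j = i then \<alpha> * ?d * x (?vs ! i) else 0) +
          (1 - \<alpha>) * (if (?vs ! i, ?vs ! j) \<in> parcs G then x (?vs ! j) else 0))"
      using i dim
      by (auto simp: scalar_prod_def A_alpha_def adjacency_mat_def degree_mat_def
            mat_diag_def algebra_simps intro!: sum.cong)
    also have "\<dots> = \<alpha> * ?d * x (?vs ! i) +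
        (1 - \<alpha>) * (\<Sum>j = 0..<?n. if (?vs ! i, ?vs ! j) \<in> parcs G then x (?vs ! j) else 0)"
      using i by (simp add: sum.distrib sum_distrib_left)
    also have "(\<Sum>j = 0..<?n. if (?vs ! i, ?vs ! j) \<in> parcs G then x (?vs ! j) else 0) =
        (\<Sum>w\<in>pverts G. if (?vs ! i, w) \<in> parcs G then x w else 0)"
      by (rule sum.reindex_bij_betw[OF bij])
    finally show ?thesis .
  qed
  have all: "(\<forall>v\<in>pverts G. P v) \<longleftrightarrow> (\<forall>i<?n. P (?vs ! i))" for P
    using vs by (metis in_set_conv_nth)
  have eq: "eigenvector (A_alpha \<alpha> G) (vec ?n (\<lambda>i. x (?vs ! i))) k \<longleftrightarrow>
     (\<exists>v\<in>pverts G. x v \<noteq> 0) \<and>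
      (\<forall>v\<in>pverts G. \<alpha> * real (out_degree (with_proj G) v) * x v +
        (1 - \<alpha>) * (\<Sum>w\<in>pverts G. if (v, w) \<in> parcs G then x w else 0) = k * x v)"
    for x :: "'a \<Rightarrow> real"
  proof -
    have "vec ?n (\<lambda>i. x (?vs ! i)) = 0\<^sub>v ?n \<longleftrightarrow> (\<forall>v\<in>pverts G. x v = 0)"
      unfolding all by (auto simp: vec_eq_iff)
    moreover have "A_alpha \<alpha> G *\<^sub>v vec ?n (\<lambda>i. x (?vs ! i)) = k \<cdot>\<^sub>v vec ?n (\<lambda>i. x (?vs ! i)) \<longleftrightarrow>
      (\<forall>v\<in>pverts G. \<alpha> * real (out_degree (with_proj G) v) * x v +
        (1 - \<alpha>) * (\<Sum>w\<in>pverts G. if (v, w) \<in> parcs G then x w else 0) = k * x v)"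
      unfolding all vec_eq_iff using row dim by (auto simp del: index_mult_mat_vec)
    ultimately show ?thesis
      unfolding eigenvector_def dim by auto
  qed
  show ?thesis
  proof
    assume ?L
    then obtain y where y: "eigenvector (A_alpha \<alpha> G) y k" by (auto simp: eigenvalue_def)
    then have "y \<in> carrier_vec ?n" by (simp add: eigenvector_def dim)
    define x where "x v = y $ the_inv_into {0..<?n} ((!) ?vs) v" for v
    have "x (?vs ! i) = y $ i" if "i < ?n" for i
      using that bij by (simp add: x_def the_inv_into_f_f bij_betw_def)
    then have "y = vec ?n (\<lambda>i. x (?vs ! i))" using \<open>y \<in> _\<close> by auto
    with y have "eigenvector (A_alpha \<alpha> G) (vec ?n (\<lambda>i. x (?vs ! i))) k" by simp
    then show ?R unfolding eq by (rule exI[where x = x])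
  next
    assume ?R
    then show ?L unfolding eq[symmetric] eigenvalue_def by (elim exE) (rule exI)
  qed
qed

end

theory Submission
  imports Defs "Jordan_Normal_Form.Spectral_Radius" "HOL-Analysis.Function_Topology"
begin

text \<open>
  Let \<open>x \<ge> 0\<close> maximise the Rayleigh quotient of \<open>A\<^sub>\<alpha>(T)\<close>, whose numerator is a sum of edge
  energies \<open>\<alpha> (x\<^sub>a\<^sup>2 + x\<^sub>b\<^sup>2) + 2 (1 - \<alpha>) x\<^sub>a x\<^sub>b\<close>. Root \<open>T\<close> at a vertex \<open>u\<close> where \<open>x\<close> is largest.
  As \<open>T\<close> is not a star, some \<open>z\<close> has distance 2 from \<open>u\<close>. Reattaching every vertex other than
  \<open>u\<close> and \<open>z\<close> to \<open>u\<close> does not decrease any edge energy and turns \<open>T\<close> into \<open>D\<^sub>n\<^sub>,\<^sub>1\<close>, which gives the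
  inequality. In case of equality \<open>x\<close> is an eigenvector of both matrices for the same eigenvalue.
  Comparing the rows of \<open>u\<close> shows that \<open>x\<close> vanishes at each reattached vertex that was not adjacent
  to \<open>u\<close>. Such a vertex is a leaf at \<open>u\<close> in \<open>D\<^sub>n\<^sub>,\<^sub>1\<close>, so its row forces \<open>x\<^sub>u = 0\<close>, a contradiction.
\<close>

section \<open>Quadratic forms on the unit sphere\<close>

definition quad_form :: "('a \<Rightarrow> 'a \<Rightarrow> real) \<Rightarrow> 'a set \<Rightarrow> ('a \<Rightarrow> real) \<Rightarrow> real" where
  "quad_form M V x = (\<Sum>a\<in>V. \<Sum>b\<in>V. M a b * x a * x b)"

lemma quad_form_eq_sum_rows:
  "quad_form M V x = (\<Sum>a\<in>V. x a * (\<Sum>b\<in>V. M a b * x b))"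
  by (simp add: quad_form_def sum_distrib_left algebra_simps)

lemma quad_form_scale: "quad_form M V (\<lambda>v. c * x v) = c\<^sup>2 * quad_form M V x"
  by (simp add: quad_form_def sum_distrib_left power2_eq_square algebra_simps)

text \<open>The unit sphere is compact and the form continuous, so a maximiser exists; homogeneity
  of degree 2 extends the bound from the sphere to all \<open>y\<close>.\<close>

lemma quad_form_max_attained:
  fixes M :: "'a \<Rightarrow> 'a \<Rightarrow> real"
  assumes fin: "finite V" and "V \<noteq> {}"
  obtains x where "(\<Sum>v\<in>V. (x v)\<^sup>2) = 1"
    and "\<And>y. quad_form M V y \<le> quad_form M V x * (\<Sum>v\<in>V. (y v)\<^sup>2)"
proof -
  define N where "N x = (\<Sum>v\<in>V. (x v)\<^sup>2)" for x :: "'a \<Rightarrow> real"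
  \<comment> \<open>The functions are total on \<open>'a\<close>, so the coordinates outside
    \<open>V\<close> are pinned to 0; the box is then compact by Tychonoff's theorem.\<close>
  define K where "K = PiE UNIV (\<lambda>v. if v \<in> V then {-1..1::real} else {0})"
  have "compactin (product_topology (\<lambda>i. euclidean) UNIV) K"
    unfolding K_def compactin_PiE by auto
  then have "compact K"
    by (simp add: euclidean_product_topology compactin_euclidean_iff)
  have cont: "continuous_on A (\<lambda>x. x v)" for A :: "('a \<Rightarrow> real) set" and v :: 'a
    by (rule continuous_on_subset[OF continuous_on_product_coordinates]) simp
  have "continuous_on UNIV N"
    unfolding N_def by (intro continuous_intros cont)
  then have "closed (N -` {1})" by (intro closed_vimage) auto
  with \<open>compact K\<close> have comp: "compact (K \<inter> N -` {1})" by (rule compact_Int_closed)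
  obtain w where "w \<in> V" using \<open>V \<noteq> {}\<close> by blast
  have "(\<Sum>v\<in>V. (if v = w then 1 else 0 :: real)\<^sup>2) = 1"
    using fin \<open>w \<in> V\<close> by (simp add: if_distrib[of "\<lambda>t. t\<^sup>2"] cong: if_cong)
  then have ne: "(\<lambda>v. if v = w then 1 else 0) \<in> K \<inter> N -` {1}"
    using \<open>w \<in> V\<close> by (auto simp: K_def N_def)
  have "continuous_on (K \<inter> N -` {1}) (quad_form M V)"
    unfolding quad_form_def by (intro continuous_intros cont)
  then obtain x where x: "x \<in> K \<inter> N -` {1}"
    and max: "\<And>y. y \<in> K \<inter> N -` {1} \<Longrightarrow> quad_form M V y \<le> quad_form M V x"
    using continuous_attains_sup[OF comp] ne by blast
  have "quad_form M V y \<le> quad_form M V x * N y" for y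
  proof (cases "N y = 0")
    case True
    then have "\<forall>v\<in>V. y v = 0" using fin by (auto simp: N_def sum_nonneg_eq_0_iff)
    then show ?thesis by (simp add: True quad_form_def)
  next
    case False
    then have pos: "N y > 0" by (simp add: N_def less_le sum_nonneg)
    \<comment> \<open>Scaling by \<open>c\<close> puts \<open>y\<close> on the sphere, and cutting
      it off outside \<open>V\<close> puts it into \<open>K\<close> without changing the
      form.\<close>
    define c where "c = 1 / sqrt (N y)"
    define z where "z v = (if v \<in> V then c * y v else 0)" for v
    have c: "c\<^sup>2 = 1 / N y" using pos by (simp add: c_def power_divide)
    have "N z = c\<^sup>2 * N y"
      by (simp add: N_def z_def power_mult_distrib sum_distrib_left)
    then have Nz: "N z = 1" using pos c by simp
    have "(z v)\<^sup>2 \<le> 1" if "v \<in> V" for v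
      using member_le_sum[OF that _ fin, of "\<lambda>v. (z v)\<^sup>2"] Nz by (simp add: N_def)
    then have "z \<in> K"
      by (auto simp: K_def z_def abs_square_le_1 abs_le_iff split: if_splits)
    then have "quad_form M V z \<le> quad_form M V x" using Nz by (intro max) auto
    moreover have "quad_form M V z = quad_form M V (\<lambda>v. c * y v)"
      by (simp add: quad_form_def z_def)
    ultimately show ?thesis
      using pos by (simp add: quad_form_scale c field_simps)
  qed
  with x show thesis by (intro that[of x]) (auto simp: N_def)
qed

text \<open>This is the first-order condition at a maximiser of the Rayleigh quotient: varying only
  the coordinate \<open>u\<close> yields the row of \<open>u\<close> in the eigenvalue
  equation.\<close>

lemma quad_form_max_eigenvector:
  fixes M :: "'a \<Rightarrow> 'a \<Rightarrow> real"
  assumes fin: "finite V" and sym: "\<And>a b. a \<in> V \<Longrightarrow> b \<in> V \<Longrightarrow> M a b = M b a"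
    and le: "\<And>y. quad_form M V y \<le> k * (\<Sum>v\<in>V. (y v)\<^sup>2)"
    and eq: "quad_form M V x = k * (\<Sum>v\<in>V. (x v)\<^sup>2)"
    and u: "u \<in> V"
  shows "(\<Sum>w\<in>V. M u w * x w) = k * x u"
proof -
  define e where "e v = (if v = u then 1 else 0 :: real)" for v
  define r where "r = (\<Sum>w\<in>V. M u w * x w)"
  have delta: "(\<Sum>v\<in>V. e v * g v) = g u" for g
    using fin u by (simp add: e_def if_distrib[of "\<lambda>t. t * _"] cong: if_cong)
  have quad: "quad_form M V (\<lambda>v. x v + t * e v) = quad_form M V x + 2 * t * r + t\<^sup>2 * M u u" for t
  proof -
    have row: "(\<Sum>b\<in>V. M a b * (x b + t * e b)) = (\<Sum>b\<in>V. M a b * x b) + t * M a u" for a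
      using delta[of "M a"] by (simp add: algebra_simps sum.distrib flip: sum_distrib_left)
    have col: "(\<Sum>a\<in>V. x a * M a u) = r"
      unfolding r_def using sym u by (intro sum.cong) auto
    have "quad_form M V (\<lambda>v. x v + t * e v) =
        (\<Sum>a\<in>V. x a * (\<Sum>b\<in>V. M a b * x b)) + t * (\<Sum>a\<in>V. x a * M a u) +
        t * (\<Sum>a\<in>V. e a * ((\<Sum>b\<in>V. M a b * x b) + t * M a u))"
      unfolding quad_form_eq_sum_rows row
      by (simp add: algebra_simps sum.distrib sum_distrib_left)
    then show ?thesis
      unfolding delta col quad_form_eq_sum_rows[symmetric]
      by (simp add: r_def power2_eq_square algebra_simps)
  qed
  have norm: "(\<Sum>v\<in>V. (x v + t * e v)\<^sup>2) = (\<Sum>v\<in>V. (x v)\<^sup>2) + 2 * t * x u + t\<^sup>2" for t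
  proof -
    have "(x v + t * e v)\<^sup>2 = (x v)\<^sup>2 + e v * (2 * t * x v + t\<^sup>2)" for v
      by (simp add: e_def power2_eq_square algebra_simps)
    then show ?thesis by (simp add: sum.distrib delta)
  qed
  \<comment> \<open>The terms constant in \<open>t\<close> cancel by \<open>eq\<close>. A linear
    term bounded by a quadratic one for all \<open>t\<close> of either sign must vanish.\<close>
  have lin: "2 * t * (r - k * x u) \<le> t\<^sup>2 * (k - M u u)" for t
    using le[of "\<lambda>v. x v + t * e v"] unfolding quad norm eq by (simp add: algebra_simps)
  have "r - k * x u = 0"
  proof (rule ccontr)
    define d where "d = r - k * x u"
    \<comment> \<open>The choice \<open>t = d / C\<close> turns \<open>lin\<close> into
      \<open>2 * d^2 / C \<le> d^2 / C\<close>. The summand 1 keeps \<open>C\<close>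
      positive.\<close>
    define C where "C = \<bar>k - M u u\<bar> + 1"
    assume "r - k * x u \<noteq> 0"
    then have "d \<noteq> 0" "C > 0" by (auto simp: d_def C_def)
    have "2 * (d / C) * d \<le> (d / C)\<^sup>2 * (k - M u u)" unfolding d_def by (rule lin)
    also have "\<dots> \<le> (d / C)\<^sup>2 * C" by (intro mult_left_mono) (auto simp: C_def)
    finally have "d\<^sup>2 \<le> 0"
      using \<open>C > 0\<close> by (simp add: power2_eq_square field_simps)
    with \<open>d \<noteq> 0\<close> show False by simp
  qed
  then show ?thesis by (simp add: r_def)
qed

section \<open>Edge energies and the quadratic form of the matrix\<close>

definition edge_energy :: "real \<Rightarrow> real \<Rightarrow> real \<Rightarrow> real" where
  "edge_energy \<alpha> s t = \<alpha> * (s\<^sup>2 + t\<^sup>2) + 2 * (1 - \<alpha>) * s * t"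

definition arc_energy :: "real \<Rightarrow> 'a pair_pre_digraph \<Rightarrow> ('a \<Rightarrow> real) \<Rightarrow> real" where
  "arc_energy \<alpha> G x = (\<Sum>(a, b)\<in>parcs G. edge_energy \<alpha> (x a) (x b))"

text \<open>Indexing the entries by vertices instead of positions in \<open>vertex_list\<close>
  keeps the chosen ordering out of the argument.\<close>

definition A_alpha_entry :: "real \<Rightarrow> 'a pair_pre_digraph \<Rightarrow> 'a \<Rightarrow> 'a \<Rightarrow> real" where
  "A_alpha_entry \<alpha> G a b =
     (if a = b then \<alpha> * real (out_degree (with_proj G) a) else 0) +
     (1 - \<alpha>) * (if (a, b) \<in> parcs G then 1 else 0)"

lemma edge_energy_commute: "edge_energy \<alpha> s t = edge_energy \<alpha> t s"
  by (simp add: edge_energy_def)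

text \<open>For nonnegative values both summands grow with \<open>t\<close>. Hence moving one end of
  an edge to a vertex of larger value cannot lower its energy.\<close>

lemma edge_energy_mono:
  assumes "0 \<le> \<alpha>" "\<alpha> \<le> 1" "0 \<le> s" "0 \<le> t" "t \<le> t'"
  shows "edge_energy \<alpha> s t \<le> edge_energy \<alpha> s t'"
  unfolding edge_energy_def using assms
  by (intro add_mono mult_left_mono power_mono) auto

text \<open>The squares ignore signs and the mixed term has the nonnegative factor
  \<open>1 - \<alpha>\<close>; so a maximiser may be replaced by its absolute value.\<close>

lemma edge_energy_abs:
  assumes "0 \<le> \<alpha>" "\<alpha> \<le> 1"
  shows "edge_energy \<alpha> s t \<le> edge_energy \<alpha> \<bar>s\<bar> \<bar>t\<bar>"
proof -
  have "(1 - \<alpha>) * (s * t) \<le> (1 - \<alpha>) * (\<bar>s\<bar> * \<bar>t\<bar>)"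
    using assms by (intro mult_left_mono) (auto simp flip: abs_mult)
  then show ?thesis by (simp add: edge_energy_def algebra_simps)
qed

lemma pair_graph_sym:
  assumes "pair_graph G" shows "(a, b) \<in> parcs G \<longleftrightarrow> (b, a) \<in> parcs G"
proof -
  interpret pair_graph G by fact
  show ?thesis using pair_sym_arcs by (auto simp: symmetric_def sym_def)
qed

lemma pair_graphD:
  assumes "pair_graph G"
  shows "finite (pverts G)" "finite (parcs G)" "parcs G \<subseteq> pverts G \<times> pverts G" "(a, a) \<notin> parcs G"
proof -
  interpret pair_graph G by fact
  show "finite (pverts G)" "finite (parcs G)" "parcs G \<subseteq> pverts G \<times> pverts G" "(a, a) \<notin> parcs G"
    using pair_finite_verts pair_finite_arcs in_arcsD1 in_arcsD2 pair_no_loops[of "(a, a)"] by auto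
qed

lemma sum_parcs:
  fixes f :: "'a \<Rightarrow> 'a \<Rightarrow> 'b::comm_monoid_add"
  assumes "pair_graph G"
  shows "(\<Sum>(a, b)\<in>parcs G. f a b) = (\<Sum>a\<in>pverts G. \<Sum>b\<in>{b. (a, b) \<in> parcs G}. f a b)"
proof -
  have "parcs G = (SIGMA a:pverts G. {b. (a, b) \<in> parcs G})"
    using pair_graphD(3)[OF assms] by auto
  moreover have "finite {b. (a, b) \<in> parcs G}" for a
    by (rule finite_subset[OF _ pair_graphD(1)[OF assms]]) (use pair_graphD(3)[OF assms] in auto)
  ultimately show ?thesis
    using pair_graphD(1)[OF assms] by (subst sum.Sigma) auto
qed

lemma out_degree_with_proj:
  "out_degree (with_proj G) a = card {b. (a, b) \<in> parcs G}"
proof -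
  have "out_arcs (with_proj G) a = Pair a ` {b. (a, b) \<in> parcs G}"
    by (auto simp: out_arcs_def)
  then show ?thesis by (simp add: out_degree_def card_image inj_on_def)
qed

lemma sum_neighbours:
  fixes x :: "'a \<Rightarrow> 'b::comm_monoid_add"
  assumes "pair_graph G"
  shows "(\<Sum>b\<in>pverts G. if (a, b) \<in> parcs G then x b else 0) = (\<Sum>b\<in>{b. (a, b) \<in> parcs G}. x b)"
proof -
  have "{b. (a, b) \<in> parcs G} = {b \<in> pverts G. (a, b) \<in> parcs G}"
    using pair_graphD(3)[OF assms] by auto
  then show ?thesis using pair_graphD(1)[OF assms] by (simp add: sum.inter_filter)
qed

lemma A_alpha_entry_row:
  assumes "pair_graph G" "a \<in> pverts G"
  shows "(\<Sum>b\<in>pverts G. A_alpha_entry \<alpha> G a b * x b) =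
    \<alpha> * real (out_degree (with_proj G) a) * x a + (1 - \<alpha>) * (\<Sum>b\<in>{b. (a, b) \<in> parcs G}. x b)"
proof -
  have fin: "finite (pverts G)" using assms pair_graphD by auto
  have "A_alpha_entry \<alpha> G a b * x b =
      (if a = b then \<alpha> * real (out_degree (with_proj G) a) * x a else 0) +
      (1 - \<alpha>) * (if (a, b) \<in> parcs G then x b else 0)" for b
    by (simp add: A_alpha_entry_def algebra_simps)
  then show ?thesis
    using fin assms(2) by (simp add: sum.distrib sum_neighbours[OF assms(1)] flip: sum_distrib_left)
qed

lemma eigenvalue_A_alpha_entry:
  assumes "pair_graph G"
  shows "eigenvalue (A_alpha \<alpha> G) k \<longleftrightarrow>
    (\<exists>x. (\<exists>v\<in>pverts G. x v \<noteq> 0) \<and>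
      (\<forall>v\<in>pverts G. (\<Sum>w\<in>pverts G. A_alpha_entry \<alpha> G v w * x w) = k * x v))"
proof -
  have fin: "finite (pverts G)" using assms pair_graphD by auto
  show ?thesis
    unfolding eigenvalue_A_alpha_iff[OF fin] sum_neighbours[OF assms] using A_alpha_entry_row[OF assms] by simp
qed

text \<open>Each edge is counted by two arcs, hence the factor 2.\<close>

lemma arc_energy_eq_quad_form:
  assumes "pair_graph G"
  shows "arc_energy \<alpha> G x = 2 * quad_form (A_alpha_entry \<alpha> G) (pverts G) x"
proof -
  have swap: "prod.swap e \<in> parcs G" if "e \<in> parcs G" for e
    using that pair_graph_sym[OF assms, of "fst e" "snd e"] by (cases e) simp
  \<comment> \<open>Reversing all arcs exchanges heads and tails, and each vertex is the tail of as
    many arcs as its out-degree.\<close>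
  have "(\<Sum>(a, b)\<in>parcs G. (x b)\<^sup>2) = (\<Sum>(a, b)\<in>parcs G. (x a)\<^sup>2)"
    by (rule sum.reindex_bij_witness[of _ prod.swap prod.swap])
      (simp_all add: swap case_prod_unfold)
  also have "\<dots> = (\<Sum>a\<in>pverts G. real (out_degree (with_proj G) a) * (x a)\<^sup>2)"
    by (simp add: sum_parcs[OF assms] out_degree_with_proj)
  finally have b: "(\<Sum>(a, b)\<in>parcs G. (x b)\<^sup>2) =
      (\<Sum>a\<in>pverts G. real (out_degree (with_proj G) a) * (x a)\<^sup>2)" .
  have a: "(\<Sum>(a, b)\<in>parcs G. (x a)\<^sup>2) =
      (\<Sum>a\<in>pverts G. real (out_degree (with_proj G) a) * (x a)\<^sup>2)"
    by (simp add: sum_parcs[OF assms] out_degree_with_proj)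
  have "arc_energy \<alpha> G x =
      \<alpha> * ((\<Sum>(a, b)\<in>parcs G. (x a)\<^sup>2) + (\<Sum>(a, b)\<in>parcs G. (x b)\<^sup>2)) +
      2 * (1 - \<alpha>) * (\<Sum>(a, b)\<in>parcs G. x a * x b)"
    unfolding arc_energy_def edge_energy_def case_prod_unfold sum.distrib[symmetric] sum_distrib_left
    by (simp add: algebra_simps)
  also have "\<dots> = 2 * (\<Sum>a\<in>pverts G. x a * (\<alpha> * real (out_degree (with_proj G) a) * x a +
      (1 - \<alpha>) * (\<Sum>b\<in>{b. (a, b) \<in> parcs G}. x b)))"
    unfolding a b sum_parcs[OF assms, of "\<lambda>a b. x a * x b"]
    by (simp add: sum.distrib sum_distrib_left power2_eq_square algebra_simps)
  finally show ?thesis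
    by (simp add: quad_form_eq_sum_rows A_alpha_entry_row[OF assms])
qed

section \<open>The largest eigenvalue as maximal Rayleigh quotient\<close>

lemma A_alpha_entry_sym:
  "pair_graph G \<Longrightarrow> A_alpha_entry \<alpha> G a b = A_alpha_entry \<alpha> G b a"
  using pair_graph_sym[of G a b] by (simp add: A_alpha_entry_def)

text \<open>The maximum \<open>k\<close> of the form on the sphere is an eigenvalue by the
  first-order condition, and testing the form on an eigenvector of any eigenvalue \<open>l\<close>
  gives \<open>l \<le> k\<close>.\<close>

lemma rho_alpha_attained:
  assumes G: "pair_graph G" and ne: "pverts G \<noteq> {}"
  obtains x where "(\<Sum>v\<in>pverts G. (x v)\<^sup>2) = 1"
    and "arc_energy \<alpha> G x = 2 * rho_alpha \<alpha> G"
    and "\<And>y. arc_energy \<alpha> G y \<le> 2 * rho_alpha \<alpha> G * (\<Sum>v\<in>pverts G. (y v)\<^sup>2)"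
proof -
  let ?M = "A_alpha_entry \<alpha> G" and ?V = "pverts G"
  have fin: "finite ?V" using pair_graphD[OF G] by simp
  obtain x where x: "(\<Sum>v\<in>?V. (x v)\<^sup>2) = 1"
    and max: "\<And>y. quad_form ?M ?V y \<le> quad_form ?M ?V x * (\<Sum>v\<in>?V. (y v)\<^sup>2)"
    using quad_form_max_attained[OF fin ne, of ?M] by blast
  define k where "k = quad_form ?M ?V x"
  have "\<forall>v\<in>?V. (\<Sum>w\<in>?V. ?M v w * x w) = k * x v"
    using quad_form_max_eigenvector[where M = ?M, OF fin A_alpha_entry_sym[OF G] max] x by (simp add: k_def)
  moreover have "\<exists>v\<in>?V. x v \<noteq> 0" using x by (metis power_zero_numeral sum.neutral zero_neq_one)
  ultimately have ev: "eigenvalue (A_alpha \<alpha> G) k"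
    unfolding eigenvalue_A_alpha_entry[OF G] by blast
  have le: "l \<le> k" if l: "eigenvalue (A_alpha \<alpha> G) l" for l
  proof -
    obtain y where y: "\<exists>v\<in>?V. y v \<noteq> 0" "\<forall>v\<in>?V. (\<Sum>w\<in>?V. ?M v w * y w) = l * y v"
      using l unfolding eigenvalue_A_alpha_entry[OF G] by blast
    have "quad_form ?M ?V y = l * (\<Sum>v\<in>?V. (y v)\<^sup>2)"
      unfolding quad_form_eq_sum_rows using y(2)
      by (simp add: sum_distrib_left power2_eq_square algebra_simps)
    moreover have "(\<Sum>v\<in>?V. (y v)\<^sup>2) > 0" using y(1) fin by (auto intro: sum_pos2)
    ultimately show ?thesis using max[of y] by (simp add: k_def)
  qed
  have "A_alpha \<alpha> G \<in> carrier_mat (card ?V) (card ?V)"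
    by (simp add: A_alpha_def adjacency_mat_def degree_mat_def)
  \<comment> \<open>\<open>Max\<close> is meaningful only on a finite set of eigenvalues.\<close>
  then have "finite {k. eigenvalue (A_alpha \<alpha> G) k}"
    using card_finite_spectrum(1) unfolding spectrum_def by blast
  then have "rho_alpha \<alpha> G = k"
    unfolding rho_alpha_def using ev le by (intro Max_eqI) auto
  then show thesis
    using x max by (intro that[of x]) (auto simp: arc_energy_eq_quad_form[OF G] k_def)
qed

lemma arc_energy_le_rho_alpha:
  assumes "pair_graph G" "pverts G \<noteq> {}"
  shows "arc_energy \<alpha> G y \<le> 2 * rho_alpha \<alpha> G * (\<Sum>v\<in>pverts G. (y v)\<^sup>2)"
  using rho_alpha_attained[OF assms] by blast

text \<open>Equality in the Rayleigh bound makes \<open>x\<close> a maximiser, so the first-order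
  condition supplies the row of each vertex. In the equality case this gives rows for both
  trees.\<close>

lemma rho_alpha_eigenvector:
  assumes G: "pair_graph G" and v: "v \<in> pverts G"
    and eq: "arc_energy \<alpha> G x = 2 * rho_alpha \<alpha> G * (\<Sum>v\<in>pverts G. (x v)\<^sup>2)"
  shows "\<alpha> * real (card {w. (v, w) \<in> parcs G}) * x v + (1 - \<alpha>) * (\<Sum>w\<in>{w. (v, w) \<in> parcs G}. x w) =
    rho_alpha \<alpha> G * x v"
proof -
  have "pverts G \<noteq> {}" using v by auto
  then have "quad_form (A_alpha_entry \<alpha> G) (pverts G) y \<le> rho_alpha \<alpha> G * (\<Sum>v\<in>pverts G. (y v)\<^sup>2)" for y
    using arc_energy_le_rho_alpha[OF G, of \<alpha> y] by (simp add: arc_energy_eq_quad_form[OF G])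
  moreover have "quad_form (A_alpha_entry \<alpha> G) (pverts G) x = rho_alpha \<alpha> G * (\<Sum>v\<in>pverts G. (x v)\<^sup>2)"
    using eq by (simp add: arc_energy_eq_quad_form[OF G])
  ultimately have "(\<Sum>w\<in>pverts G. A_alpha_entry \<alpha> G v w * x w) = rho_alpha \<alpha> G * x v"
    using v by (intro quad_form_max_eigenvector pair_graphD(1)[OF G] A_alpha_entry_sym[OF G])
  then show ?thesis
    by (simp add: A_alpha_entry_row[OF G v] out_degree_with_proj)
qed

lemma rho_alpha_nonneg_eigenvector:
  assumes G: "pair_graph G" "pverts G \<noteq> {}" and "0 \<le> \<alpha>" "\<alpha> \<le> 1"
  obtains x where "\<And>v. 0 \<le> x v" "(\<Sum>v\<in>pverts G. (x v)\<^sup>2) = 1"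
    and "arc_energy \<alpha> G x = 2 * rho_alpha \<alpha> G"
proof -
  obtain x where x: "(\<Sum>v\<in>pverts G. (x v)\<^sup>2) = 1" "arc_energy \<alpha> G x = 2 * rho_alpha \<alpha> G"
    using rho_alpha_attained[OF G] by blast
  have "arc_energy \<alpha> G x \<le> arc_energy \<alpha> G (\<lambda>v. \<bar>x v\<bar>)"
    unfolding arc_energy_def using assms by (intro sum_mono) (auto intro: edge_energy_abs)
  moreover have "arc_energy \<alpha> G (\<lambda>v. \<bar>x v\<bar>) \<le> 2 * rho_alpha \<alpha> G"
    using arc_energy_le_rho_alpha[OF G, of \<alpha> "\<lambda>v. \<bar>x v\<bar>"] x by simp
  ultimately show thesis using x by (intro that[of "\<lambda>v. \<bar>x v\<bar>"]) auto
qed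

section \<open>Isomorphisms and invariance of the largest eigenvalue\<close>

lemma digraph_iso_with_projI:
  assumes G: "pair_graph G" and bij: "bij_betw g (pverts G) (pverts H)"
    and arcs: "parcs H = map_prod g g ` parcs G"
  shows "digraph_iso (with_proj G) (with_proj H)"
proof -
  interpret pair_graph G by fact
  let ?f = "\<lparr>iso_verts = g, iso_arcs = map_prod g g, iso_head = snd, iso_tail = fst\<rparr>"
  have inj: "inj_on g (pverts G)" using bij by (rule bij_betw_imp_inj_on)
  then have "inj_on (map_prod g g) (parcs G)"
    using inj_on_subset[OF map_prod_inj_on[OF inj inj] pair_graphD(3)[OF G]] by simp
  then have "pre_digraph.digraph_isomorphism (with_proj G) ?f"
    unfolding pre_digraph.digraph_isomorphism_def using inj by (auto simp: wf_digraph_wp_iff pair_wf_digraph_axioms)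
  moreover have "with_proj H = app_iso ?f (with_proj G)"
    using bij arcs by (simp add: app_iso_def with_proj_def bij_betw_def)
  ultimately show ?thesis unfolding digraph_iso_def by blast
qed

text \<open>The isomorphism record has a separate map on arcs; since tail and head are the
  projections in both graphs, the vertex map determines it.\<close>

lemma digraph_iso_with_projE:
  assumes "digraph_iso (with_proj G) (with_proj H)"
  obtains g where "bij_betw g (pverts G) (pverts H)" "parcs H = map_prod g g ` parcs G"
proof -
  obtain f where f: "pre_digraph.digraph_isomorphism (with_proj G) f"
    and H: "with_proj H = app_iso f (with_proj G)"
    using assms by (auto simp: digraph_iso_def)
  have H': "pverts H = iso_verts f ` pverts G" "parcs H = iso_arcs f ` parcs G"
    "iso_tail f = fst" "iso_head f = snd"
    using arg_cong[OF H, of verts] arg_cong[OF H, of arcs] arg_cong[OF H, of tail]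
      arg_cong[OF H, of head] by simp_all
  have "iso_arcs f e = map_prod (iso_verts f) (iso_verts f) e" if "e \<in> parcs G" for e
    using f that H'(3,4) by (auto simp: pre_digraph.digraph_isomorphism_def prod_eq_iff)
  then have "parcs H = map_prod (iso_verts f) (iso_verts f) ` parcs G"
    using H'(2) by (simp cong: image_cong)
  moreover have "bij_betw (iso_verts f) (pverts G) (pverts H)"
    using f H'(1) by (simp add: pre_digraph.digraph_isomorphism_def bij_betw_def)
  ultimately show thesis by (rule that[rotated])
qed

text \<open>Pulling a maximiser for \<open>H\<close> back along the vertex bijection preserves
  energy and norm. Equality comes from using the isomorphism in both directions.\<close>

lemma rho_alpha_iso_le:
  assumes G: "pair_graph G" "pverts G \<noteq> {}" and H: "pair_graph H"
    and iso: "digraph_iso (with_proj G) (with_proj H)"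
  shows "rho_alpha \<alpha> H \<le> rho_alpha \<alpha> G"
proof -
  obtain g where bij: "bij_betw g (pverts G) (pverts H)" and arcs: "parcs H = map_prod g g ` parcs G"
    using digraph_iso_with_projE[OF iso] by blast
  have inj: "inj_on (map_prod g g) (parcs G)"
    using inj_on_subset[OF map_prod_inj_on pair_graphD(3)[OF G(1)]] bij_betw_imp_inj_on[OF bij] by blast
  have "pverts H \<noteq> {}" using bij G(2) by (auto simp: bij_betw_def)
  then obtain x where x: "(\<Sum>v\<in>pverts H. (x v)\<^sup>2) = 1" "arc_energy \<alpha> H x = 2 * rho_alpha \<alpha> H"
    using rho_alpha_attained[OF H] by blast
  have "arc_energy \<alpha> H x = arc_energy \<alpha> G (x \<circ> g)"
    unfolding arc_energy_def arcs by (subst sum.reindex[OF inj]) (simp add: case_prod_unfold)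
  also have "\<dots> \<le> 2 * rho_alpha \<alpha> G * (\<Sum>v\<in>pverts G. ((x \<circ> g) v)\<^sup>2)"
    by (rule arc_energy_le_rho_alpha[OF G])
  also have "(\<Sum>v\<in>pverts G. ((x \<circ> g) v)\<^sup>2) = 1"
    using sum.reindex_bij_betw[OF bij, of "\<lambda>v. (x v)\<^sup>2"] x by simp
  finally show ?thesis using x by simp
qed

section \<open>Connectedness, and trees as parent functions\<close>

lemma connected_crossing_arc:
  assumes G: "pair_graph G" and con: "Digraph_Component.connected (with_proj G)"
    and S: "u \<in> S" "S \<subset> pverts G"
  obtains a b where "(a, b) \<in> parcs G" "a \<in> S" "b \<in> pverts G - S"
proof (rule ccontr)
  assume no: "\<not> thesis"
  obtain v where v: "v \<in> pverts G" "v \<notin> S" using S by blast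
  \<comment> \<open>Connectedness is defined through the symmetric closure, which adds no arcs here.
    Without a crossing arc, everything reachable from \<open>u\<close> stays in
    \<open>S\<close>.\<close>
  have sym: "parcs (mk_symmetric (with_proj G)) = parcs G"
    using pair_graph_sym[OF G] by (auto simp: parcs_mk_symmetric)
  have "u \<in> pverts G" using S by blast
  then have "u \<rightarrow>\<^sup>*\<^bsub>with_proj (mk_symmetric (with_proj G))\<^esub> v"
    using con v(1) by (auto simp: connected_def strongly_connected_def)
  then have "(u, v) \<in> (parcs G)\<^sup>*"
    using reachable_rtranclI sym by fastforce
  then have "v \<in> S"
  proof (induction rule: rtrancl_induct)
    case base show ?case by (rule S)
  next
    case (step a b)
    then show ?case using no that pair_graphD(3)[OF G] by blast
  qed
  with v show False by simp
qed

lemma pawalk_verts_snoc: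
  "pcas a q b \<Longrightarrow> pawalk_verts a (q @ [(b, c)]) = pawalk_verts a q @ [c]"
  by (induction q arbitrary: a) auto

lemma pcas_snoc: "pcas a q b \<Longrightarrow> pcas a (q @ [(b, c)]) c"
  by (induction q arbitrary: a) auto

text \<open>A second neighbour of \<open>v\<close> in \<open>S\<close> would close a cycle through a simple path inside \<open>S\<close>.
  Hence a tree can be exhausted by adding one vertex at a time, each with a unique parent.\<close>

lemma tree_new_vertex_unique_neighbour:
  assumes T: "undirected_tree T"
    and v: "v \<in> pverts T - S" "(s, v) \<in> parcs T" "s \<in> S"
    and paths: "\<And>a b. a \<in> S \<Longrightarrow> b \<in> S \<Longrightarrow>
      \<exists>q. set q \<subseteq> parcs T \<and> pcas a q b \<and> distinct (pawalk_verts a q) \<and> set (pawalk_verts a q) \<subseteq> S"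
    and t: "(t, v) \<in> parcs T" "t \<in> S"
  shows "t = s"
proof (rule ccontr)
  assume "t \<noteq> s"
  have G: "pair_graph T" using T by (simp add: undirected_tree_def)
  interpret pair_graph T by fact
  obtain q where q: "set q \<subseteq> parcs T" "pcas t q s" "distinct (pawalk_verts t q)"
    "set (pawalk_verts t q) \<subseteq> S"
    using paths[OF t(2) v(3)] by blast
  let ?c = "(v, t) # q @ [(s, v)]"
  have "(v, t) \<in> parcs T" using t pair_graph_sym[OF G] by blast
  then have "awalk v ?c v"
    using q v pcas_snoc[OF q(2), of v] by (auto simp: awalk_def)
  moreover have "distinct (tl (pawalk_verts v ?c))"
    using q v by (auto simp: pawalk_verts_snoc[OF q(2)])
  ultimately have "cycle ?c" unfolding cycle_def by blast
  \<comment> \<open>Since \<open>t\<close> and \<open>s\<close> differ, the path between them has an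
    arc, which rules out a closed walk of length 2.\<close>
  moreover have "q \<noteq> []" using q(2) \<open>t \<noteq> s\<close> by auto
  then have "3 \<le> length ?c" by (cases q) auto
  ultimately show False using T unfolding undirected_tree_def by blast
qed

text \<open>Induction on the number of vertices reached from the root \<open>u\<close>. The simple
  paths inside \<open>S\<close> are carried along because they force the next vertex to have only
  one neighbour in \<open>S\<close>. The condition \<open>p (p v) \<noteq> v\<close> keeps the two
  orientations apart; it is restricted to \<open>p v \<noteq> u\<close> because \<open>p\<close> is
  unspecified at the root.\<close>

lemma tree_parent_partial:
  assumes T: "undirected_tree T" and u: "u \<in> pverts T" and "k < card (pverts T)"
  shows "\<exists>S p. u \<in> S \<and> S \<subseteq> pverts T \<and> card S = Suc k \<and>
    (\<forall>v\<in>S - {u}. p v \<in> S \<and> (v, p v) \<in> parcs T \<and> (p v \<noteq> u \<longrightarrow> p (p v) \<noteq> v)) \<and>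
    (\<forall>a\<in>S. \<forall>b\<in>S. (a, b) \<in> parcs T \<longrightarrow> a \<noteq> u \<and> b = p a \<or> b \<noteq> u \<and> a = p b) \<and>
    (\<forall>a\<in>S. \<forall>b\<in>S. \<exists>q. set q \<subseteq> parcs T \<and> pcas a q b \<and> distinct (pawalk_verts a q) \<and>
      set (pawalk_verts a q) \<subseteq> S)"
  using assms(3)
proof (induction k)
  have G: "pair_graph T" using T by (simp add: undirected_tree_def)
  case 0
  show ?case
    by (rule exI[of _ "{u}"]) (use u pair_graphD(4)[OF G] in \<open>auto intro!: exI[of _ "[]"]\<close>)
next
  have G: "pair_graph T" using T by (simp add: undirected_tree_def)
  case (Suc k)
  from Suc.IH[OF Suc_lessD[OF Suc.prems]] obtain S p where
    S: "u \<in> S" "S \<subseteq> pverts T" "card S = Suc k"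
    and p_ball: "\<forall>v\<in>S - {u}. p v \<in> S \<and> (v, p v) \<in> parcs T \<and> (p v \<noteq> u \<longrightarrow> p (p v) \<noteq> v)"
    and arcs: "\<forall>a\<in>S. \<forall>b\<in>S. (a, b) \<in> parcs T \<longrightarrow> a \<noteq> u \<and> b = p a \<or> b \<noteq> u \<and> a = p b"
    and paths_ball: "\<forall>a\<in>S. \<forall>b\<in>S. \<exists>q. set q \<subseteq> parcs T \<and> pcas a q b \<and> distinct (pawalk_verts a q) \<and>
      set (pawalk_verts a q) \<subseteq> S"
    by (elim exE conjE) (simp only:)
  have p: "p v \<in> S \<and> (v, p v) \<in> parcs T \<and> (p v \<noteq> u \<longrightarrow> p (p v) \<noteq> v)"
    if "v \<in> S" "v \<noteq> u" for v
    using p_ball that by blast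
  note paths = paths_ball[rule_format]
  have "S \<subset> pverts T" using S Suc.prems by auto
  then obtain s v where v: "(s, v) \<in> parcs T" "s \<in> S" "v \<in> pverts T - S"
    using connected_crossing_arc[OF G _ S(1)] T unfolding undirected_tree_def by blast
  have vs: "(v, s) \<in> parcs T" using v pair_graph_sym[OF G] by blast
  have unique: "t = s" if "(t, v) \<in> parcs T" "t \<in> S" for t
    by (rule tree_new_vertex_unique_neighbour[OF T v(3,1,2) paths that])
  let ?S = "insert v S" and ?p = "p(v := s)"
  have "finite S" using S(3) by (simp add: card_ge_0_finite)
  then have card: "card ?S = Suc (Suc k)" using S v by auto
  have p': "?p a \<in> ?S \<and> (a, ?p a) \<in> parcs T \<and> (?p a \<noteq> u \<longrightarrow> ?p (?p a) \<noteq> a)"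
    if "a \<in> ?S" "a \<noteq> u" for a
  proof (cases "a = v")
    case True
    then show ?thesis using v vs p[of s] by auto
  next
    case False
    then have "a \<in> S" using that by simp
    from p[OF this that(2)] show ?thesis using False v by auto
  qed
  have arcs': "a \<noteq> u \<and> b = ?p a \<or> b \<noteq> u \<and> a = ?p b"
    if ab: "a \<in> ?S" "b \<in> ?S" "(a, b) \<in> parcs T" for a b
  proof -
    have "a \<noteq> b" using ab pair_graphD(4)[OF G] by auto
    moreover have "(b, a) \<in> parcs T" using ab pair_graph_sym[OF G] by blast
    \<comment> \<open>An arc that meets the new vertex \<open>v\<close> joins it to
      \<open>s\<close>: there are no loops, and \<open>s\<close> is its only neighbour in
      \<open>S\<close>.\<close>
    ultimately consider "a = v" "b = s" | "b = v" "a = s" | "a \<in> S" "b \<in> S"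
      using ab unique by blast
    then show ?thesis
      using arcs ab(3) v S by cases auto
  qed
  have paths': "\<exists>q. set q \<subseteq> parcs T \<and> pcas a q b \<and> distinct (pawalk_verts a q) \<and> set (pawalk_verts a q) \<subseteq> ?S"
    if ab: "a \<in> ?S" "b \<in> ?S" for a b
  proof -
    consider "a = v" "b = v" | "a = v" "b \<in> S" | "a \<in> S" "b = v" | "a \<in> S" "b \<in> S"
      using ab by blast
    then show ?thesis
    proof cases
      case 1
      then show ?thesis by (intro exI[of _ "[]"]) auto
    next
      case 2
      obtain q where q: "set q \<subseteq> parcs T" "pcas s q b" "distinct (pawalk_verts s q)"
        "set (pawalk_verts s q) \<subseteq> S" using paths[OF v(2) 2(2)] by blast
      then show ?thesis using 2 v vs by (intro exI[of _ "(v, s) # q"]) auto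
    next
      case 3
      obtain q where q: "set q \<subseteq> parcs T" "pcas a q s" "distinct (pawalk_verts a q)"
        "set (pawalk_verts a q) \<subseteq> S" using paths[OF 3(1) v(2)] by blast
      then show ?thesis
        using 3 v pcas_snoc[OF q(2), of v]
        by (intro exI[of _ "q @ [(s, v)]"]) (auto simp: pawalk_verts_snoc[OF q(2)])
    next
      case 4
      then show ?thesis using paths[OF 4] by blast
    qed
  qed
  show ?case
    by (rule exI[of _ ?S], rule exI[of _ ?p])
      (intro conjI ballI impI, use S v card in blast, use S v in blast, use card in blast,
       use p' in blast, use p' in blast, use p' in blast, use arcs' in blast, use paths' in blast)
qed

text \<open>Every edge is the parent edge of exactly one non-root vertex, so sums over arcs become
  sums over non-root vertices.\<close>

lemma tree_parent:
  assumes T: "undirected_tree T" and u: "u \<in> pverts T"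
  obtains p where "p ` (pverts T - {u}) \<subseteq> pverts T"
    and "parcs T = (\<lambda>v. (v, p v)) ` (pverts T - {u}) \<union> (\<lambda>v. (p v, v)) ` (pverts T - {u})"
    and "(\<lambda>v. (v, p v)) ` (pverts T - {u}) \<inter> (\<lambda>v. (p v, v)) ` (pverts T - {u}) = {}"
proof -
  have G: "pair_graph T" using T by (simp add: undirected_tree_def)
  have fin: "finite (pverts T)" using pair_graphD[OF G] by simp
  then have "card (pverts T) > 0" using u card_gt_0_iff by blast
  \<comment> \<open>The set reached after \<open>card (pverts T) - 1\<close> additions has full
    cardinality and is therefore the whole vertex set.\<close>
  then have "card (pverts T) - 1 < card (pverts T)" "Suc (card (pverts T) - 1) = card (pverts T)"
    by auto
  from tree_parent_partial[OF T u this(1)] this(2) obtain S p where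
    S: "S \<subseteq> pverts T" "card S = card (pverts T)"
    and p: "\<forall>v\<in>S - {u}. p v \<in> S \<and> (v, p v) \<in> parcs T \<and> (p v \<noteq> u \<longrightarrow> p (p v) \<noteq> v)"
    and arcs: "\<forall>a\<in>S. \<forall>b\<in>S. (a, b) \<in> parcs T \<longrightarrow> a \<noteq> u \<and> b = p a \<or> b \<noteq> u \<and> a = p b"
    by (elim exE conjE) (simp only:)
  have "S = pverts T" using card_subset_eq[OF fin S] .
  note p = p[unfolded this] and arcs = arcs[unfolded this]
  show thesis
  proof (rule that[of p])
    show "p ` (pverts T - {u}) \<subseteq> pverts T" using p by blast
    show "parcs T = (\<lambda>v. (v, p v)) ` (pverts T - {u}) \<union> (\<lambda>v. (p v, v)) ` (pverts T - {u})"
    proof (intro subset_antisym subsetI)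
      fix e assume e: "e \<in> parcs T"
      obtain a b where ab: "e = (a, b)" by (cases e)
      with e pair_graphD(3)[OF G] have "a \<in> pverts T" "b \<in> pverts T" by auto
      with arcs e ab show "e \<in> (\<lambda>v. (v, p v)) ` (pverts T - {u}) \<union> (\<lambda>v. (p v, v)) ` (pverts T - {u})"
        by blast
    next
      fix e assume "e \<in> (\<lambda>v. (v, p v)) ` (pverts T - {u}) \<union> (\<lambda>v. (p v, v)) ` (pverts T - {u})"
      then show "e \<in> parcs T" using p pair_graph_sym[OF G] by blast
    qed
    show "(\<lambda>v. (v, p v)) ` (pverts T - {u}) \<inter> (\<lambda>v. (p v, v)) ` (pverts T - {u}) = {}"
      using p by blast
  qed
qed

section \<open>Sums over parent edges, and \<open>D_n1\<close> as a rooted tree\<close>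

lemma sum_both_orientations:
  fixes g :: "'a \<Rightarrow> 'a \<Rightarrow> real"
  assumes "finite W" and "(\<lambda>v. (v, p v)) ` W \<inter> (\<lambda>v. (p v, v)) ` W = {}"
    and "\<And>a b. g a b = g b a"
  shows "(\<Sum>(a, b)\<in>(\<lambda>v. (v, p v)) ` W \<union> (\<lambda>v. (p v, v)) ` W. g a b) = 2 * (\<Sum>v\<in>W. g v (p v))"
proof -
  have "(\<Sum>(a, b)\<in>(\<lambda>v. (v, p v)) ` W. g a b) = (\<Sum>v\<in>W. g v (p v))"
    by (subst sum.reindex) (auto simp: inj_on_def)
  moreover have "(\<Sum>(a, b)\<in>(\<lambda>v. (p v, v)) ` W. g a b) = (\<Sum>v\<in>W. g v (p v))"
    by (subst sum.reindex) (auto simp: inj_on_def assms(3) intro: sum.cong)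
  ultimately show ?thesis
    using assms(1,2) by (subst sum.union_disjoint) auto
qed

lemma bij_betw_fun_upd_insert:
  assumes "bij_betw f A B" "a \<notin> A" "b \<notin> B"
  shows "bij_betw (f(a := b)) (insert a A) (insert b B)"
  using assms by (auto simp: bij_betw_def inj_on_def)

lemma bij_betw_fun_upd_notin: "bij_betw f A B \<Longrightarrow> a \<notin> A \<Longrightarrow> bij_betw (f(a := b)) A B"
  by (subst bij_betw_cong[where g = f]) auto

text \<open>The parent function of \<open>D_n1\<close> rooted at 0, for the non-root vertices
  \<open>{1..<n}\<close>: only the leaf 2 hangs at 1.\<close>

definition D_n1_parent :: "nat \<Rightarrow> nat" where
  "D_n1_parent j = (if j = 2 then 1 else 0)"

lemma parcs_D_n1:
  assumes "n \<ge> 4"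
  shows "parcs (D_n1 n) =
    (\<lambda>j. (j, D_n1_parent j)) ` {1..<n} \<union> (\<lambda>j. (D_n1_parent j, j)) ` {1..<n}"
proof -
  have "{1..<n} = {1, 2} \<union> {3..<n}" using assms by auto
  then show ?thesis
    by (auto simp: D_n1_def undirected_graph_def D_n1_parent_def image_iff)
qed

lemma pverts_D_n1: "pverts (D_n1 n) = {0..<n}"
  by (simp add: D_n1_def undirected_graph_def)

lemma neighbours_D_n1:
  assumes "n \<ge> 4"
  shows "{w. (0, w) \<in> parcs (D_n1 n)} = {1..<n} - {2}"
    and "3 \<le> j \<Longrightarrow> j < n \<Longrightarrow> {w. (j, w) \<in> parcs (D_n1 n)} = {0}"
  using assms by (auto simp: D_n1_def undirected_graph_def)

lemma arc_energy_D_n1: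
  assumes "n \<ge> 4"
  shows "arc_energy \<alpha> (D_n1 n) y = 2 * (\<Sum>j\<in>{1..<n}. edge_energy \<alpha> (y j) (y (D_n1_parent j)))"
  unfolding arc_energy_def parcs_D_n1[OF assms]
  by (rule sum_both_orientations)
    (auto simp: D_n1_parent_def edge_energy_commute split: if_splits)

text \<open>A bijection that respects roots and commutes with the parent functions carries parent
  edges to parent edges. It serves for the star (\<open>q\<close> constantly 0) and for
  \<open>D_n1\<close>.\<close>

lemma digraph_iso_parent:
  fixes H :: "nat pair_pre_digraph" and T :: "'a pair_pre_digraph"
  assumes H: "pair_graph H" "pverts H = {0..<n}"
    "parcs H = (\<lambda>j. (j, q j)) ` {1..<n} \<union> (\<lambda>j. (q j, j)) ` {1..<n}"
    and T: "parcs T = (\<lambda>v. (v, p v)) ` (pverts T - {u}) \<union> (\<lambda>v. (p v, v)) ` (pverts T - {u})"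
    and g: "bij_betw g {0..<n} (pverts T)" "bij_betw g {1..<n} (pverts T - {u})"
    and parent: "\<And>j. j \<in> {1..<n} \<Longrightarrow> p (g j) = g (q j)"
  shows "digraph_iso (with_proj T) (with_proj H)"
proof -
  have W: "pverts T - {u} = g ` {1..<n}" using g(2) by (simp add: bij_betw_def)
  have "parcs T = map_prod g g ` parcs H"
    unfolding T H(3) W image_Un image_image map_prod_simp
    by (intro arg_cong2[where f = "(\<union>)"] image_cong refl) (simp_all only: parent)
  then have iso: "digraph_iso (with_proj H) (with_proj T)"
    using H g(1) by (intro digraph_iso_with_projI[of H g]) auto
  interpret pair_graph H by fact
  have "wf_digraph (with_proj H)" by (simp add: wf_digraph_wp_iff pair_wf_digraph_axioms)
  then show ?thesis using iso by (rule digraph_iso_swap)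
qed

section \<open>Comparison of the tree with \<open>D_n1\<close> and the equality case\<close>

theorem theorem3p4:
  fixes T :: "'a pair_pre_digraph" and n :: nat and \<alpha> :: real
  assumes "undirected_tree T"
    and "card (pverts T) = n" and "n \<ge> 4"
    and "\<not> digraph_iso (with_proj T) (with_proj (star n))"
    and "0 \<le> \<alpha>" and "\<alpha> < 1"
  shows "rho_alpha \<alpha> T \<le> rho_alpha \<alpha> (D_n1 n) \<and>
    (rho_alpha \<alpha> T = rho_alpha \<alpha> (D_n1 n) \<longleftrightarrow>
      digraph_iso (with_proj T) (with_proj (D_n1 n)))"
proof -
  let ?V = "pverts T" and ?D = "D_n1 n"
  have T: "pair_graph T" and con: "Digraph_Component.connected (with_proj T)"
    using assms(1) by (auto simp: undirected_tree_def)
  have D: "pair_graph ?D" using pair_graph_D_n1 assms(3) .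
  have fin: "finite ?V" using pair_graphD[OF T] by simp
  have ne: "?V \<noteq> {}" "pverts ?D \<noteq> {}" using assms(2,3) by (auto simp: pverts_D_n1)
  obtain x where x_nonneg: "\<And>v. 0 \<le> x v" and x_norm: "(\<Sum>v\<in>?V. (x v)\<^sup>2) = 1"
    and x_max: "arc_energy \<alpha> T x = 2 * rho_alpha \<alpha> T"
    using rho_alpha_nonneg_eigenvector[OF T ne(1)] assms(5,6) by (metis less_imp_le)
  obtain u where u: "u \<in> ?V" and x_le: "\<And>v. v \<in> ?V \<Longrightarrow> x v \<le> x u"
  proof -
    have "Max (x ` ?V) \<in> x ` ?V" using fin ne by (intro Max_in) auto
    then obtain u where "u \<in> ?V" "x u = Max (x ` ?V)" by auto
    with fin show thesis by (intro that[of u]) auto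
  qed
  have "x u \<noteq> 0"
  proof
    assume "x u = 0"
    then have "x v = 0" if "v \<in> ?V" for v using x_le[OF that] x_nonneg[of v] by simp
    then show False using x_norm by simp
  qed
  obtain p where p: "p ` (?V - {u}) \<subseteq> ?V"
    and arcs: "parcs T = (\<lambda>v. (v, p v)) ` (?V - {u}) \<union> (\<lambda>v. (p v, v)) ` (?V - {u})"
    and disj: "(\<lambda>v. (v, p v)) ` (?V - {u}) \<inter> (\<lambda>v. (p v, v)) ` (?V - {u}) = {}"
    by (rule tree_parent[OF assms(1) u]) (rule that; assumption)
  have root: "p v = u" "v \<noteq> u" "v \<in> ?V" if "(u, v) \<in> parcs T" for v
    using that unfolding arcs by auto
  \<comment> \<open>If \<open>u\<close> were the parent of every other vertex, any bijection sending
    0 to \<open>u\<close> would identify \<open>T\<close> with the star.\<close>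
  have "\<exists>v\<in>?V - {u}. p v \<noteq> u"
  proof (rule ccontr)
    assume star: "\<not> (\<exists>v\<in>?V - {u}. p v \<noteq> u)"
    have "card {1..<n} = card (?V - {u})" using assms(2) u fin by simp
    then obtain h where h: "bij_betw h {1..<n} (?V - {u})"
      using fin by (metis finite_Diff finite_atLeastLessThan finite_same_card_bij)
    define g where "g = h(0 := u)"
    have *: "insert 0 {1..<n} = {0..<n}" "insert u (?V - {u}) = ?V" using assms(3) u by auto
    have g: "bij_betw g {0..<n} ?V"
      using bij_betw_fun_upd_insert[OF h, of 0 u] unfolding * by (simp add: g_def)
    have g': "bij_betw g {1..<n} (?V - {u})"
      unfolding g_def using h by (rule bij_betw_fun_upd_notin) simp
    have "digraph_iso (with_proj T) (with_proj (star n))"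
    proof (rule digraph_iso_parent[OF pair_graph_star _ _ arcs g g', where q = "\<lambda>_. 0"])
      show "pverts (star n) = {0..<n}" by (simp add: star_def undirected_graph_def)
      show "parcs (star n) = (\<lambda>j. (j, 0)) ` {1..<n} \<union> (\<lambda>j. (0, j)) ` {1..<n}"
        by (auto simp: star_def undirected_graph_def)
      show "p (g j) = g 0" if "j \<in> {1..<n}" for j
        using star bij_betwE[OF g'] that by (auto simp: g_def)
    qed
    with assms(4) show False by simp
  qed
  then obtain v where v: "v \<in> ?V" "v \<noteq> u" "p v \<noteq> u" by blast
  \<comment> \<open>The closed neighbourhood of \<open>u\<close> misses the vertex \<open>v\<close>
    just found. An arc leaving it starts at a neighbour \<open>w\<close> of \<open>u\<close> and
    ends at a vertex \<open>z\<close> at distance 2.\<close>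
  let ?S = "insert u {v. (u, v) \<in> parcs T}"
  have "?S \<subset> ?V" using u v root by blast
  then obtain w z where wz: "(w, z) \<in> parcs T" "w \<in> ?S" "z \<in> ?V - ?S"
    using connected_crossing_arc[OF T con, of u ?S] by blast
  then have uw: "(u, w) \<in> parcs T" by auto
  have w: "w \<in> ?V" "w \<noteq> u" "p w = u" using root[OF uw] by auto
  have z: "z \<in> ?V" "z \<noteq> u" "z \<noteq> w" "(u, z) \<notin> parcs T" using wz uw by auto
  \<comment> \<open>The other orientation of the parent edge would give
    \<open>z = p w = u\<close>.\<close>
  have pz: "p z = w" using wz(1) w z unfolding arcs by auto
  have "card {3..<n} = card (?V - {u, w, z})"
    using assms(2,3) u w z fin by (subst card_Diff_subset) auto
  then obtain h where h: "bij_betw h {3..<n} (?V - {u, w, z})"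
    using fin by (metis finite_Diff finite_atLeastLessThan finite_same_card_bij)
  \<comment> \<open>The labels 0, 1, 2 of \<open>D_n1\<close> go to \<open>u\<close>,
    \<open>w\<close>, \<open>z\<close>; the remaining vertices are matched arbitrarily with the
    leaves at 0.\<close>
  define g where "g = h(2 := z, 1 := w, 0 := u)"
  have g_simps: "g 0 = u" "g 1 = w" "g 2 = z" by (simp_all add: g_def)
  have ins: "insert 1 (insert 2 {3..<n}) = {1..<n}" "insert w (insert z (?V - {u, w, z})) = ?V - {u}"
    "insert 0 {1..<n} = {0..<n}" "insert u (?V - {u}) = ?V"
    using assms(3) u w z by auto
  have h': "bij_betw (h(2 := z, 1 := w)) {1..<n} (?V - {u})"
    using bij_betw_fun_upd_insert[OF bij_betw_fun_upd_insert[OF h, of 2 z], of 1 w] z(3)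
    unfolding ins by simp
  have g: "bij_betw g {0..<n} ?V"
    using bij_betw_fun_upd_insert[OF h', of 0 u] unfolding ins g_def by simp
  have g': "bij_betw g {1..<n} (?V - {u})"
    unfolding g_def using h' by (rule bij_betw_fun_upd_notin) simp
  define y where "y = x \<circ> g"
  have y_norm: "(\<Sum>j\<in>pverts ?D. (y j)\<^sup>2) = 1"
    using sum.reindex_bij_betw[OF g, of "\<lambda>v. (x v)\<^sup>2"] x_norm by (simp add: y_def pverts_D_n1)
  have "arc_energy \<alpha> T x = 2 * (\<Sum>v\<in>?V - {u}. edge_energy \<alpha> (x v) (x (p v)))"
    unfolding arc_energy_def arcs using fin disj
    by (intro sum_both_orientations) (auto simp: edge_energy_commute)
  also have "\<dots> = 2 * (\<Sum>j\<in>{1..<n}. edge_energy \<alpha> (x (g j)) (x (p (g j))))"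
    using sum.reindex_bij_betw[OF g', of "\<lambda>v. edge_energy \<alpha> (x v) (x (p v))"] by simp
  \<comment> \<open>The edge from \<open>z\<close> to \<open>w\<close> is kept. Every other vertex
    exchanges its parent for \<open>u\<close>, where \<open>x\<close> is largest.\<close>
  also have "\<dots> \<le> arc_energy \<alpha> ?D y"
    unfolding arc_energy_D_n1[OF assms(3)]
  proof (intro mult_left_mono sum_mono)
    fix j assume j: "j \<in> {1..<n}"
    show "edge_energy \<alpha> (x (g j)) (x (p (g j))) \<le> edge_energy \<alpha> (y j) (y (D_n1_parent j))"
    proof (cases "j = 2")
      case True
      then show ?thesis using g_simps pz by (simp add: y_def D_n1_parent_def)
    next
      case False
      have "p (g j) \<in> ?V" using bij_betwE[OF g'] j p by blast
      then show ?thesis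
        using False x_nonneg x_le assms(5,6) g_simps
        by (auto simp: y_def D_n1_parent_def intro: edge_energy_mono)
    qed
  qed simp
  finally have T_le_y: "2 * rho_alpha \<alpha> T \<le> arc_energy \<alpha> ?D y" using x_max by simp
  have y_le_D: "arc_energy \<alpha> ?D y \<le> 2 * rho_alpha \<alpha> ?D"
    using arc_energy_le_rho_alpha[OF D ne(2), of \<alpha> y] y_norm by simp
  have "digraph_iso (with_proj T) (with_proj ?D)" if eq: "rho_alpha \<alpha> T = rho_alpha \<alpha> ?D"
  proof -
    let ?r = "rho_alpha \<alpha> T" and ?N = "{v. (u, v) \<in> parcs T}"
    have y_max: "arc_energy \<alpha> ?D y = 2 * rho_alpha \<alpha> ?D * (\<Sum>j\<in>pverts ?D. (y j)\<^sup>2)"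
      using T_le_y y_le_D eq y_norm by simp
    have row_T: "\<alpha> * real (card ?N) * x u + (1 - \<alpha>) * (\<Sum>v\<in>?N. x v) = ?r * x u"
      using rho_alpha_eigenvector[OF T u, of \<alpha> x] x_max x_norm by simp
    \<comment> \<open>\<open>{1..<n} - {2}\<close> is the neighbourhood of 0 in \<open>D_n1\<close>.
      Carried over by \<open>g\<close>, the row of 0 becomes an equation for \<open>x u\<close>,
      comparable with \<open>row_T\<close>.\<close>
    have g'': "bij_betw g ({1..<n} - {2}) (?V - {u, z})"
    proof -
      have "bij_betw g ({1..<n} - {2}) (?V - {u} - {g 2})"
        using g' assms(3) by (intro bij_betw_DiffI) (auto simp: bij_betw_def inj_on_def)
      moreover have "?V - {u} - {g 2} = ?V - {u, z}" using g_simps by auto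
      ultimately show ?thesis by simp
    qed
    have "\<alpha> * real (card ({1..<n} - {2})) * y 0 + (1 - \<alpha>) * (\<Sum>j\<in>{1..<n} - {2}. y j) = ?r * y 0"
      using rho_alpha_eigenvector[OF D _ y_max, of 0] assms(3) eq
      by (simp add: neighbours_D_n1[OF assms(3)] pverts_D_n1)
    then have row_D: "\<alpha> * real (card (?V - {u, z})) * x u + (1 - \<alpha>) * (\<Sum>v\<in>?V - {u, z}. x v) = ?r * x u"
      using sum.reindex_bij_betw[OF g'', of x] bij_betw_same_card[OF g''] g_simps
      by (simp add: y_def)
    have N: "?N \<subseteq> ?V - {u, z}" using root z by blast
    have N_eq: "?N = ?V - {u, z}"
    proof (rule ccontr)
      assume "?N \<noteq> ?V - {u, z}"
      then obtain v where v: "v \<in> ?V - {u, z}" "v \<notin> ?N" using N by blast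
      have finN: "finite ?N" using N fin finite_subset by blast
      \<comment> \<open>The two rows have the same right-hand side, and the degree term of
        \<open>D_n1\<close> is at least that of \<open>T\<close>. So its neighbour sum is at most
        that of \<open>T\<close>, which forces \<open>x\<close> to vanish at the extra neighbour
        \<open>v\<close>.\<close>
      have "card ?N \<le> card (?V - {u, z})" using N fin by (intro card_mono) auto
      then have "\<alpha> * real (card ?N) * x u \<le> \<alpha> * real (card (?V - {u, z})) * x u"
        using assms(5) x_nonneg by (intro mult_right_mono mult_left_mono) auto
      with row_T row_D have "(1 - \<alpha>) * (\<Sum>v\<in>?V - {u, z}. x v) \<le> (1 - \<alpha>) * (\<Sum>v\<in>?N. x v)"
        by linarith
      then have "(\<Sum>v\<in>?V - {u, z}. x v) \<le> (\<Sum>v\<in>?N. x v)" using assms(6) by simp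
      moreover have "(\<Sum>v\<in>insert v ?N. x v) \<le> (\<Sum>v\<in>?V - {u, z}. x v)"
        using N v(1) fin x_nonneg by (intro sum_mono2) auto
      ultimately have "x v = 0" using v(2) finN x_nonneg[of v] by simp
      have "v \<in> g ` ({1..<n} - {2})" using v(1) bij_betw_imp_surj_on[OF g''] by simp
      then obtain j where j: "v = g j" "j \<in> {1..<n} - {2}" by (rule imageE)
      \<comment> \<open>The label 1 belongs to \<open>w\<close>, which is adjacent to
        \<open>u\<close> in \<open>T\<close>. Hence \<open>v\<close> becomes a leaf at 0, and its
        row reduces to \<open>(1 - \<alpha>) * x u = 0\<close>.\<close>
      have "j \<noteq> 1" using j(1) g_simps v(2) uw by auto
      then have "3 \<le> j" "j < n" using j(2) by auto
      then have "\<alpha> * y j + (1 - \<alpha>) * y 0 = ?r * y j"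
        using rho_alpha_eigenvector[OF D _ y_max, of j] eq
        by (simp add: neighbours_D_n1[OF assms(3)] pverts_D_n1)
      then have "x u = 0" using \<open>x v = 0\<close> j(1) g_simps assms(6) by (simp add: y_def)
      with \<open>x u \<noteq> 0\<close> show False by simp
    qed
    \<comment> \<open>By \<open>N_eq\<close> every non-root vertex except \<open>z\<close> is
      already a child of \<open>u\<close>, so reattaching has changed nothing.\<close>
    have "p (g j) = g (D_n1_parent j)" if j: "j \<in> {1..<n}" for j
    proof (cases "j = 2")
      case True
      then show ?thesis using g_simps pz by (simp add: D_n1_parent_def)
    next
      case False
      then have "g j \<in> ?N" unfolding N_eq using j by (intro bij_betw_apply[OF g'']) simp
      then show ?thesis using False root(1) g_simps by (simp add: D_n1_parent_def)
    qed
    then show ?thesis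
      by (intro digraph_iso_parent[OF D pverts_D_n1 parcs_D_n1[OF assms(3)] arcs g g'])
  qed
  moreover have "rho_alpha \<alpha> T = rho_alpha \<alpha> ?D" if iso: "digraph_iso (with_proj T) (with_proj ?D)"
  proof (rule antisym)
    interpret pair_graph T by fact
    have "digraph_iso (with_proj ?D) (with_proj T)"
      by (rule digraph_iso_swap[OF _ iso]) (simp add: wf_digraph_wp_iff pair_wf_digraph_axioms)
    then show "rho_alpha \<alpha> T \<le> rho_alpha \<alpha> ?D" by (rule rho_alpha_iso_le[OF D ne(2) T])
    show "rho_alpha \<alpha> ?D \<le> rho_alpha \<alpha> T" by (rule rho_alpha_iso_le[OF T ne(1) D iso])
  qed
  ultimately show ?thesis using T_le_y y_le_D by auto
qed

end
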